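(* Let $A=A^{T}\in\mathbb{R}^{n\times n}$ with eigen-decomposition $A=Q\Lambda Q^{T}$, let $k>0$, $p\ge 0$ be integers with $(p+1)k<n$, let $m$ be an integer with $m\in[k,k+pk]$, and let $X\in\mathbb{R}^{n\times k}$. Let $V$, $G$, $G_1$ and $Y$ be constructed from $A$, $X$, $p$, $m$ as described in the context, and suppose that the first $m$ rows of $G$ are linearly independent (the $G_1$-Assumption). Then $$\delta_{k}(Y)\le\Gamma_{k,m}(Q^{T}X)\,\Gamma_{k,m}(V)\,\left\|G_{1}^{\dagger}E_{k}\right\|_{2}.$$ Furthermore, $$\frac{\delta_{k}(Y)}{\delta_{k}(X)}\le\frac{\max_{j>m}\|q_{j}^{T}X\|}{\max_{j>k}\|q_{j}^{T}X\|}\,\Gamma_{k,m}(V)\,\left\|G_{1}^{\dagger}E_{k}\right\|_{2}.$$ Here $E_k\in\mathbb{R}^{m\times k}$ consists of the first $k$ columns of the $m\times m$ identity matrix.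
   Context: Eigen-decomposition: $\Lambda=\mathrm{diag}(\lambda_1,\dots,\lambda_n)$ with $\lambda_1\ge\lambda_2\ge\cdots\ge\lambda_n$, and $Q=[q_1,\dots,q_n]$ is orthogonal with $Aq_i=\lambda_iq_i$. $\|\cdot\|$ is the Euclidean norm of a (row) vector, $\|\cdot\|_2$ is the spectral norm of a matrix, and $e_i$ is the $i$-th column of an identity matrix of appropriate size. For $Z\in\mathbb{R}^{n\times k}$, $\displaystyle\delta_k(Z)=\frac{\max_{i>k}\|q_i^TZ\|}{\min_{i\le k}\|q_i^TZ\|}$. For any matrix $M$ with $n$ rows, $\displaystyle\Gamma_{k,m}(M)=\frac{\max_{i>m}\|e_i^TM\|}{\min_{i\le k}\|e_i^TM\|}$. Quotients are understood under the proviso that their denominators are nonzero. Construction. $V\in\mathbb{R}^{n\times(p+1)}$ is the matrix with $i$-th row $(1,\lambda_i,\lambda_i^2,\dots,\lambda_i^p)$. $\mathbf{X}_p=[X\ \ AX\ \cdots\ A^pX]\in\mathbb{R}^{n\times(p+1)k}$. $\hat G=[Q^TX\ \ \Lambda Q^TX\ \cdots\ \Lambda^pQ^TX]$, so that $\mathbf{X}_p=Q\hat G$. $D$ is the $n\times n$ diagonal matrix with $D_{ii}=\|e_i^T\hat G\|=\|q_i^TX\|\,\|e_i^TV\|$. $D^\dagger$ is its pseudo-inverse (diagonal, with entry $1/D_{ii}$ if $D_{ii}\ne0$ and $0$ otherwise). $G=D^\dagger\hat G$, so that $\mathbf{X}_p=QDG$. Partition $D=\mathrm{diag}(D_1,D_2)$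 with $D_1$ of size $m\times m$, and let $G_1$ be the first $m$ rows of $G$. Under the $G_1$-Assumption, $D_1$ is invertible and the pseudo-inverse $G_1^\dagger$ satisfies $G_1G_1^\dagger=I_{m\times m}$. Define $\mathbf{Y}_p=\mathbf{X}_pG_1^\dagger D_1^{-1}\in\mathbb{R}^{n\times m}$, and let $Y\in\mathbb{R}^{n\times k}$ consist of the first $k$ columns of $\mathbf{Y}_p$. *)

theory Defs
  imports "Jordan_Normal_Form.Gauss_Jordan_Elimination" "Jordan_Normal_Form.VS_Connect"
begin

text \<open>Indices are 0-based throughout: the range \<open>i \<le> k\<close> of the mathematics is \<open>{..<k}\<close> here and
  \<open>i > m\<close> is \<open>{m..<n}\<close>.\<close>

definition vnorm :: "real vec \<Rightarrow> real" where
  "vnorm v = sqrt (v \<bullet> v)"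

definition spectral_norm :: "real mat \<Rightarrow> real" where
  "spectral_norm M = Sup {vnorm (M *\<^sub>v x) | x. x \<in> carrier_vec (dim_col M) \<and> vnorm x \<le> 1}"

definition first_rows :: "nat \<Rightarrow> real mat \<Rightarrow> real mat" where
  "first_rows m M = mat m (dim_col M) (\<lambda>(i, j). M $$ (i, j))"

definition first_cols :: "nat \<Rightarrow> real mat \<Rightarrow> real mat" where
  "first_cols k M = mat (dim_row M) k (\<lambda>(i, j). M $$ (i, j))"

text \<open>Moore--Penrose inverse, characterized by the four Penrose equations.\<close>

definition is_pinv :: "real mat \<Rightarrow> real mat \<Rightarrow> bool" where
  "is_pinv M B \<longleftrightarrow> B \<in> carrier_mat (dim_col M) (dim_row M) \<and>
     M * B * M = M \<and> B * M * B = B \<and>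
     transpose_mat (M * B) = M * B \<and> transpose_mat (B * M) = B * M"

definition pinv :: "real mat \<Rightarrow> real mat" where
  "pinv M = (THE B. is_pinv M B)"

text \<open>The rows are independent as a family, so repeated rows have to be excluded.\<close>

definition rows_lin_indpt :: "real mat \<Rightarrow> bool" where
  "rows_lin_indpt M \<longleftrightarrow> distinct (rows M) \<and>
     \<not> module.lin_dep class_ring (module_vec TYPE(real) (dim_col M)) (set (rows M))"

text \<open>\<open>qnorm Q Z i\<close> is \<open>\<parallel>q\<^sub>i\<^sup>T Z\<parallel>\<close>, with the row vector \<open>q\<^sub>i\<^sup>T Z\<close> written as \<open>Z\<^sup>T q\<^sub>i\<close>.\<close>

definition qnorm :: "real mat \<Rightarrow> real mat \<Rightarrow> nat \<Rightarrow> real" where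
  "qnorm Q Z i = vnorm (transpose_mat Z *\<^sub>v col Q i)"

definition delta :: "real mat \<Rightarrow> nat \<Rightarrow> real mat \<Rightarrow> real" where
  "delta Q k Z = (MAX i\<in>{k..<dim_row Z}. qnorm Q Z i) / (MIN i\<in>{..<k}. qnorm Q Z i)"

definition Gamma :: "nat \<Rightarrow> nat \<Rightarrow> real mat \<Rightarrow> real" where
  "Gamma k m M = (MAX i\<in>{m..<dim_row M}. vnorm (row M i)) / (MIN i\<in>{..<k}. vnorm (row M i))"

definition vander :: "nat \<Rightarrow> (nat \<Rightarrow> real) \<Rightarrow> nat \<Rightarrow> real mat" where
  "vander n lam p = mat n (p + 1) (\<lambda>(i, j). lam i ^ j)"

text \<open>The block matrix \<open>[Z, B Z, \<dots>, B\<^sup>p Z]\<close>: column \<open>j\<close> is column \<open>j mod k\<close> of block \<open>j div k\<close>,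
  where \<open>k\<close> is the number of columns of \<open>Z\<close>.\<close>

definition krylov :: "real mat \<Rightarrow> real mat \<Rightarrow> nat \<Rightarrow> real mat" where
  "krylov B Z p = mat (dim_row Z) ((p + 1) * dim_col Z)
     (\<lambda>(i, j). (B ^\<^sub>m (j div dim_col Z) * Z) $$ (i, j mod dim_col Z))"

definition Ghat :: "(nat \<Rightarrow> real) \<Rightarrow> real mat \<Rightarrow> real mat \<Rightarrow> nat \<Rightarrow> real mat" where
  "Ghat lam Q X p = krylov (mat_diag (dim_row X) lam) (transpose_mat Q * X) p"

definition Dmat :: "(nat \<Rightarrow> real) \<Rightarrow> real mat \<Rightarrow> real mat \<Rightarrow> nat \<Rightarrow> real mat" where
  "Dmat lam Q X p = mat_diag (dim_row X) (\<lambda>i. vnorm (row (Ghat lam Q X p) i))"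

definition diag_pinv :: "real mat \<Rightarrow> real mat" where
  "diag_pinv D = mat_diag (dim_row D) (\<lambda>i. if D $$ (i, i) \<noteq> 0 then 1 / D $$ (i, i) else 0)"

definition Gmat :: "(nat \<Rightarrow> real) \<Rightarrow> real mat \<Rightarrow> real mat \<Rightarrow> nat \<Rightarrow> real mat" where
  "Gmat lam Q X p = diag_pinv (Dmat lam Q X p) * Ghat lam Q X p"

definition G1mat :: "(nat \<Rightarrow> real) \<Rightarrow> real mat \<Rightarrow> real mat \<Rightarrow> nat \<Rightarrow> nat \<Rightarrow> real mat" where
  "G1mat lam Q X p m = first_rows m (Gmat lam Q X p)"

definition D1mat :: "(nat \<Rightarrow> real) \<Rightarrow> real mat \<Rightarrow> real mat \<Rightarrow> nat \<Rightarrow> nat \<Rightarrow> real mat" where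
  "D1mat lam Q X p m = first_cols m (first_rows m (Dmat lam Q X p))"

text \<open>\<open>mat_inverse\<close> returns \<open>None\<close> for a singular matrix; \<open>the\<close> is meaningful because the matrix is
  invertible whenever the rows of \<open>G1mat\<close> are linearly independent.\<close>

definition Yp :: "real mat \<Rightarrow> (nat \<Rightarrow> real) \<Rightarrow> real mat \<Rightarrow> real mat \<Rightarrow> nat \<Rightarrow> nat \<Rightarrow> real mat" where
  "Yp A lam Q X p m =
     krylov A X p * pinv (G1mat lam Q X p m) * the (mat_inverse (D1mat lam Q X p m))"

definition Ymat :: "real mat \<Rightarrow> (nat \<Rightarrow> real) \<Rightarrow> real mat \<Rightarrow> real mat \<Rightarrow> nat \<Rightarrow> nat \<Rightarrow> real mat" where
  "Ymat A lam Q X p m = first_cols (dim_col X) (Yp A lam Q X p m)"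

end

theory Submission
  imports Defs "Jordan_Normal_Form.DL_Rank" "HOL-Analysis.L2_Norm"
begin

text \<open>Write \<open>d i\<close> for the diagonal entries of \<open>D\<close> and \<open>g i\<close> for the rows of \<open>G\<close>. Since \<open>Q\<^sup>T\<close> turns the
  Krylov matrix of \<open>A\<close> into \<open>Ghat = D G\<close>, the \<open>i\<close>-th row of \<open>Q\<^sup>T Y\<close> is
  \<open>d i\<close> times the row \<open>g i\<close> times \<open>pinv G1 E\<^sub>k diag(d)\<^sup>-\<^sup>1\<close>. As \<open>G1 * pinv G1\<close> is the identity, this row is a unit vector
  for \<open>i < k\<close> and zero for \<open>k \<le> i < m\<close>. For \<open>i \<ge> m\<close> the row \<open>g i\<close> has norm at most 1, so the norm of
  the row is at most \<open>d i / (MIN j<k. d j)\<close> times the spectral norm of \<open>pinv G1 E\<^sub>k\<close>. The factorization of \<open>d i\<close>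
  into the norm of a row of \<open>Q\<^sup>T X\<close> and one of the Vandermonde matrix separates the two \<open>Gamma\<close> factors.\<close>

section \<open>Euclidean norm and the Cauchy-Schwarz inequality\<close>

lemma vnorm_eq_L2_set: "vnorm v = L2_set (($) v) {0..<dim_vec v}"
  unfolding vnorm_def L2_set_def scalar_prod_def by (simp add: power2_eq_square)

lemma vnorm_nonneg [simp]: "0 \<le> vnorm v"
  by (simp add: vnorm_eq_L2_set)

lemma vnorm_zero [simp]: "vnorm (0\<^sub>v n) = 0"
  by (simp add: vnorm_def)

lemma vnorm_sq: "vnorm v * vnorm v = v \<bullet> v"
  unfolding vnorm_def by (simp add: scalar_prod_def sum_nonneg)

lemma vnorm_eq_0_iff:
  assumes "v \<in> carrier_vec n"
  shows "vnorm v = 0 \<longleftrightarrow> v = 0\<^sub>v n"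
  using assms by (auto simp: vnorm_eq_L2_set L2_set_eq_0_iff)

lemma vnorm_smult: "vnorm (c \<cdot>\<^sub>v v) = \<bar>c\<bar> * vnorm v"
proof -
  have "(c \<cdot>\<^sub>v v) \<bullet> (c \<cdot>\<^sub>v v) = c\<^sup>2 * (v \<bullet> v)"
    by (simp add: scalar_prod_def sum_distrib_left power2_eq_square mult_ac)
  then show ?thesis unfolding vnorm_def by (simp add: real_sqrt_mult)
qed

lemma vnorm_mono:
  assumes "dim_vec v = dim_vec w" "\<And>i. i < dim_vec w \<Longrightarrow> \<bar>v $ i\<bar> \<le> \<bar>w $ i\<bar>"
  shows "vnorm v \<le> vnorm w"
  unfolding vnorm_eq_L2_set L2_set_def using assms
  by (auto intro!: real_sqrt_le_mono sum_mono simp: abs_le_square_iff)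

lemma abs_scalar_prod_le:
  assumes "dim_vec v = dim_vec w"
  shows "\<bar>v \<bullet> w\<bar> \<le> vnorm v * vnorm w"
proof -
  have "\<bar>v \<bullet> w\<bar> \<le> (\<Sum>i\<in>{0..<dim_vec w}. \<bar>v $ i\<bar> * \<bar>w $ i\<bar>)"
    unfolding scalar_prod_def by (rule order.trans[OF sum_abs]) (simp add: abs_mult)
  also have "\<dots> \<le> L2_set (($) v) {0..<dim_vec w} * L2_set (($) w) {0..<dim_vec w}"
    by (rule L2_set_mult_ineq)
  finally show ?thesis using assms by (simp add: vnorm_eq_L2_set)
qed

lemma vnorm_unit_vec: "i < n \<Longrightarrow> vnorm (unit_vec n i) = 1"
  by (simp add: vnorm_def)

section \<open>Spectral norm as an operator bound\<close>

text \<open>\<open>Sup\<close> on the reals is informative only for bounded nonempty sets.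
  Cauchy-Schwarz in each row bounds this set by the norm of the vector of row norms, which is the
  Frobenius norm of \<open>M\<close>.\<close>

lemma bdd_above_spectral_norm:
  "bdd_above {vnorm (M *\<^sub>v x) | x. x \<in> carrier_vec (dim_col M) \<and> vnorm x \<le> 1}"
proof (rule bdd_aboveI)
  fix y assume "y \<in> {vnorm (M *\<^sub>v x) | x. x \<in> carrier_vec (dim_col M) \<and> vnorm x \<le> 1}"
  then obtain x where x: "x \<in> carrier_vec (dim_col M)" "vnorm x \<le> 1" "y = vnorm (M *\<^sub>v x)" by auto
  have "vnorm (M *\<^sub>v x) \<le> vnorm (vec (dim_row M) (\<lambda>i. vnorm (row M i)))"
  proof (rule vnorm_mono)
    fix i assume "i < dim_vec (vec (dim_row M) (\<lambda>i. vnorm (row M i)))"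
    then have i: "i < dim_row M" by simp
    have "\<bar>row M i \<bullet> x\<bar> \<le> vnorm (row M i) * vnorm x"
      using x(1) by (intro abs_scalar_prod_le) simp
    also have "\<dots> \<le> vnorm (row M i)"
      using x(2) by (simp add: mult_left_le)
    finally show "\<bar>(M *\<^sub>v x) $ i\<bar> \<le> \<bar>vec (dim_row M) (\<lambda>i. vnorm (row M i)) $ i\<bar>"
      using i by simp
  qed simp
  then show "y \<le> vnorm (vec (dim_row M) (\<lambda>i. vnorm (row M i)))" using x by simp
qed

lemma spectral_norm_nonneg: "0 \<le> spectral_norm M"
proof -
  have "vnorm (M *\<^sub>v 0\<^sub>v (dim_col M)) \<le> spectral_norm M"
    unfolding spectral_norm_def by (rule cSup_upper[OF _ bdd_above_spectral_norm]) auto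
  then show ?thesis using vnorm_nonneg order.trans by blast
qed

lemma vnorm_mult_mat_vec_le:
  assumes x: "x \<in> carrier_vec (dim_col M)"
  shows "vnorm (M *\<^sub>v x) \<le> spectral_norm M * vnorm x"
proof (cases "vnorm x = 0")
  case True
  then have "x = 0\<^sub>v (dim_col M)" using vnorm_eq_0_iff[OF x] by simp
  then have "M *\<^sub>v x = 0\<^sub>v (dim_row M)" by auto
  then show ?thesis using True by simp
next
  case False
  then have pos: "vnorm x > 0" using vnorm_nonneg[of x] by linarith
  let ?u = "(1 / vnorm x) \<cdot>\<^sub>v x"
  have "vnorm (M *\<^sub>v ?u) \<le> spectral_norm M"
    unfolding spectral_norm_def
    by (rule cSup_upper[OF _ bdd_above_spectral_norm]) (use x pos in \<open>auto simp: vnorm_smult\<close>)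
  moreover have "M *\<^sub>v ?u = (1 / vnorm x) \<cdot>\<^sub>v (M *\<^sub>v x)"
    using x by (intro mult_mat_vec[of _ "dim_row M" "dim_col M"]) auto
  ultimately show ?thesis using pos by (simp add: vnorm_smult field_simps)
qed

text \<open>With z the image of y, z.z = y.(M z) is at most |y| times the norm of \<open>M\<close>
  times |z|, and one factor |z| cancels. This serves rows multiplied from the right by a matrix:
  written as columns they are hit by its transpose.\<close>

lemma vnorm_transpose_mult_vec_le:
  assumes y: "y \<in> carrier_vec (dim_row M)"
  shows "vnorm (transpose_mat M *\<^sub>v y) \<le> spectral_norm M * vnorm y"
proof -
  let ?z = "transpose_mat M *\<^sub>v y"
  have z: "?z \<in> carrier_vec (dim_col M)" by (simp add: carrier_vecI)
  have "vnorm ?z * vnorm ?z = ?z \<bullet> ?z" by (rule vnorm_sq)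
  also have "\<dots> = y \<bullet> (M *\<^sub>v ?z)"
    by (rule transpose_vec_mult_scalar[OF _ z y]) auto
  also have "\<dots> \<le> vnorm y * vnorm (M *\<^sub>v ?z)"
    using abs_scalar_prod_le[of y "M *\<^sub>v ?z"] y by auto
  also have "\<dots> \<le> vnorm y * (spectral_norm M * vnorm ?z)"
    using vnorm_mult_mat_vec_le[OF z] by (intro mult_left_mono) auto
  finally have "vnorm ?z * vnorm ?z \<le> (spectral_norm M * vnorm y) * vnorm ?z" by (simp add: mult_ac)
  then show ?thesis
    by (cases "vnorm ?z = 0") (auto simp: mult_le_cancel_right spectral_norm_nonneg less_le)
qed

section \<open>Row independence and the Moore-Penrose inverse\<close>

text \<open>A nonzero \<open>x\<close> in the kernel of the transpose would be the coefficients of a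
  linear relation between the rows. Distinctness lets this count as a relation on
  \<open>set (rows M)\<close>.\<close>

lemma rows_lin_indptD:
  assumes M: "M \<in> carrier_mat r c" and li: "rows_lin_indpt M"
    and x: "x \<in> carrier_vec r" and 0: "transpose_mat M *\<^sub>v x = 0\<^sub>v c"
  shows "x = 0\<^sub>v r"
proof (rule ccontr)
  assume "x \<noteq> 0\<^sub>v r"
  then have "module.lin_dep class_ring (module_vec TYPE(real) c) (set (cols (transpose_mat M)))"
    using M li x 0 by (intro vec_space.lin_depI[of _ c r x]) (auto simp: rows_lin_indpt_def)
  then show False using li M by (simp add: rows_lin_indpt_def)
qed

text \<open>A trivial kernel makes the determinant nonzero, so \<open>N\<close> is a unit of the
  matrix ring and \<open>mat_inverse\<close> cannot return \<open>None\<close>.\<close>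

lemma ex_inverse_mat:
  fixes N :: "'a :: field mat"
  assumes N: "N \<in> carrier_mat r r"
    and ker: "\<And>x. x \<in> carrier_vec r \<Longrightarrow> N *\<^sub>v x = 0\<^sub>v r \<Longrightarrow> x = 0\<^sub>v r"
  obtains B where "mat_inverse N = Some B" "B \<in> carrier_mat r r" "N * B = 1\<^sub>m r" "B * N = 1\<^sub>m r"
proof -
  have "det N \<noteq> 0" using det_0_iff_vec_prod_zero_field[OF N] ker by auto
  then have "N \<in> Units (ring_mat TYPE('a) r ())" by (rule det_non_zero_imp_unit[OF N])
  then obtain B where "mat_inverse N = Some B" using mat_inverse(1)[OF N] by fastforce
  then show thesis using mat_inverse(2)[OF N] that by auto
qed

text \<open>Makes the definite description in \<open>pinv\<close> meaningful once existence is
  known. Both \<open>M * B = M * C\<close> and \<open>B * M = C * M\<close> hold, so B = BMB = CMB =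
  CMC = C.\<close>

lemma is_pinv_unique:
  assumes B: "is_pinv M B" and C: "is_pinv M C"
  shows "B = C"
proof -
  let ?r = "dim_row M" and ?c = "dim_col M"
  have M: "M \<in> carrier_mat ?r ?c" by auto
  note b = B[unfolded is_pinv_def] and c = C[unfolded is_pinv_def]
  have Bc: "B \<in> carrier_mat ?c ?r" and Cc: "C \<in> carrier_mat ?c ?r" using b c by auto
  have MB: "M * B \<in> carrier_mat ?r ?r" and MC: "M * C \<in> carrier_mat ?r ?r"
    and BM: "B * M \<in> carrier_mat ?c ?c" and CM: "C * M \<in> carrier_mat ?c ?c"
    using M Bc Cc by auto
  \<comment> \<open>Transposing the product of the symmetric matrices \<open>M * C\<close> and
    \<open>M * B\<close> reverses their order, after which \<open>M * B * M = M\<close> absorbs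
    \<open>B\<close>.\<close>
  have "M * B = M * C * (M * B)"
    using c assoc_mult_mat[OF MC M Bc] by simp
  then have "transpose_mat (M * B) = transpose_mat (M * C * (M * B))" by simp
  also have "\<dots> = M * B * (M * C)" using transpose_mult[OF MC MB] b c by simp
  also have "\<dots> = M * C" using b assoc_mult_mat[OF MB M Cc] by simp
  finally have 1: "M * B = M * C" using b by simp
  have "B * M = B * M * (C * M)"
    using c assoc_mult_mat[OF Bc M CM] assoc_mult_mat[OF M Cc M] by simp
  then have "transpose_mat (B * M) = transpose_mat (B * M * (C * M))" by simp
  also have "\<dots> = C * M * (B * M)" using transpose_mult[OF BM CM] b c by simp
  also have "\<dots> = C * M" using b assoc_mult_mat[OF Cc M BM] assoc_mult_mat[OF M Bc M] by simp
  finally have 2: "B * M = C * M" using b by simp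
  have "B = C * M * B" using b 2 by simp
  also have "\<dots> = C * (M * C)" using assoc_mult_mat[OF Cc M Bc] 1 by simp
  also have "\<dots> = C" using assoc_mult_mat[OF Cc M Cc] c by simp
  finally show ?thesis .
qed

text \<open>For independent rows, M^T (M M^T)^(-1) is a right inverse of \<open>M\<close> and
  satisfies the Penrose equations; uniqueness identifies it with \<open>pinv M\<close>.\<close>

lemma full_row_rank_pinv:
  assumes M: "M \<in> carrier_mat r c" and li: "rows_lin_indpt M"
  shows "pinv M \<in> carrier_mat c r" "M * pinv M = 1\<^sub>m r"
proof -
  let ?T = "transpose_mat M" and ?N = "M * transpose_mat M"
  have T: "?T \<in> carrier_mat c r" and N: "?N \<in> carrier_mat r r" using M by auto
  have "x = 0\<^sub>v r" if x: "x \<in> carrier_vec r" and 0: "?N *\<^sub>v x = 0\<^sub>v r" for x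
  proof (rule rows_lin_indptD[OF M li x])
    have Tx: "?T *\<^sub>v x \<in> carrier_vec c" using T x by auto
    \<comment> \<open>The Gram matrix \<open>?N\<close> has trivial kernel because x.(M M^T x) is
      the squared norm of M^T x.\<close>
    have "vnorm (?T *\<^sub>v x) * vnorm (?T *\<^sub>v x) = x \<bullet> (M *\<^sub>v (?T *\<^sub>v x))"
      unfolding vnorm_sq by (rule transpose_vec_mult_scalar[OF M Tx x])
    also have "M *\<^sub>v (?T *\<^sub>v x) = 0\<^sub>v r" using 0 assoc_mult_mat_vec[OF M T x] by simp
    finally have "vnorm (?T *\<^sub>v x) = 0" using x by simp
    then show "?T *\<^sub>v x = 0\<^sub>v c" using vnorm_eq_0_iff[OF Tx] by simp
  qed
  then obtain S where S: "S \<in> carrier_mat r r" "?N * S = 1\<^sub>m r" "S * ?N = 1\<^sub>m r"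
    using ex_inverse_mat[OF N] by metis
  \<comment> \<open>\<open>S\<close> inherits symmetry from \<open>?N\<close>; this makes
    \<open>?T * S * M\<close> symmetric, as the last Penrose equation demands.\<close>
  have St: "transpose_mat S = S"
  proof -
    have NT: "transpose_mat ?N = ?N" using transpose_mult[OF M T] by simp
    have ST: "transpose_mat S \<in> carrier_mat r r" using S by auto
    have "transpose_mat S * ?N = 1\<^sub>m r"
      using transpose_mult[OF N S(1)] S(2) NT by simp
    then have "S = transpose_mat S * ?N * S" using S by simp
    also have "\<dots> = transpose_mat S" using assoc_mult_mat[OF ST N S(1)] S ST by simp
    finally show ?thesis by simp
  qed
  have TS: "?T * S \<in> carrier_mat c r" using T S by auto
  have MTS: "M * (?T * S) = 1\<^sub>m r" using assoc_mult_mat[OF M T S(1)] S by simp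
  have SM: "S * M \<in> carrier_mat r c" using S M by auto
  have "transpose_mat (?T * S * M) = ?T * S * M"
    using transpose_mult[OF TS M] transpose_mult[OF T S(1)] St assoc_mult_mat[OF T S(1) M] by simp
  then have "is_pinv M (?T * S)"
    unfolding is_pinv_def using TS MTS M assoc_mult_mat[OF TS M TS] right_mult_one_mat[OF TS] by simp
  then have "is_pinv M (pinv M)" and "pinv M = ?T * S"
    unfolding pinv_def using is_pinv_unique by (metis theI)+
  then show "pinv M \<in> carrier_mat c r" "M * pinv M = 1\<^sub>m r" using TS MTS by auto
qed

section \<open>Krylov matrices and their row norms\<close>

lemma mult_pow_mat_intertwine:
  fixes P :: "real mat"
  assumes A: "A \<in> carrier_mat r r" and B: "B \<in> carrier_mat s s" and P: "P \<in> carrier_mat s r"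
    and PA: "P * A = B * P"
  shows "P * (A ^\<^sub>m l) = (B ^\<^sub>m l) * P"
proof (induction l)
  case 0
  then show ?case using A B P by simp
next
  case (Suc l)
  have "P * (A ^\<^sub>m Suc l) = P * (A ^\<^sub>m l) * A"
    using assoc_mult_mat[OF P pow_carrier_mat[OF A] A] by simp
  also have "\<dots> = B ^\<^sub>m l * (P * A)"
    using Suc assoc_mult_mat[OF pow_carrier_mat[OF B] P A] by simp
  also have "\<dots> = B ^\<^sub>m Suc l * P"
    using PA assoc_mult_mat[OF pow_carrier_mat[OF B] B P] by simp
  finally show ?case .
qed

lemma mod_less_of_less_mult: "j < (a :: nat) * b \<Longrightarrow> j mod b < b"
  by (cases "b = 0") auto

lemma krylov_carrier: "Z \<in> carrier_mat r c \<Longrightarrow> krylov B Z p \<in> carrier_mat r ((p + 1) * c)"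
  by (auto simp: krylov_def)

text \<open>Block l is A^l Z, and \<open>P\<close> carries it to B^l (P Z) by the intertwining
  relation. With P = Q^T and the diagonal matrix of eigenvalues as \<open>B\<close>, the Krylov
  matrix of \<open>A\<close> becomes \<open>Ghat\<close>.\<close>

lemma mult_krylov:
  assumes A: "A \<in> carrier_mat r r" and B: "B \<in> carrier_mat s s" and P: "P \<in> carrier_mat s r"
    and PA: "P * A = B * P" and Z: "Z \<in> carrier_mat r c"
  shows "P * krylov A Z p = krylov B (P * Z) p"
proof (rule eq_matI)
  fix i j assume "i < dim_row (krylov B (P * Z) p)" "j < dim_col (krylov B (P * Z) p)"
  then have i: "i < s" and j: "j < (p + 1) * c" using P Z by (auto simp: krylov_def)
  have jc: "j mod c < c" using mod_less_of_less_mult[OF j] .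
  let ?l = "j div c"
  have AZ: "A ^\<^sub>m ?l * Z \<in> carrier_mat r c" by (rule mult_carrier_mat[OF pow_carrier_mat[OF A] Z])
  have "col (krylov A Z p) j = col (A ^\<^sub>m ?l * Z) (j mod c)"
    using j jc AZ Z by (intro eq_vecI) (auto simp: krylov_def)
  then have "(P * krylov A Z p) $$ (i, j) = (P * (A ^\<^sub>m ?l * Z)) $$ (i, j mod c)"
    using i j jc P Z AZ by (simp add: krylov_def)
  also have "P * (A ^\<^sub>m ?l * Z) = B ^\<^sub>m ?l * (P * Z)"
    using assoc_mult_mat[OF P pow_carrier_mat[OF A] Z] assoc_mult_mat[OF pow_carrier_mat[OF B] P Z]
      mult_pow_mat_intertwine[OF A B P PA] by metis
  finally show "(P * krylov A Z p) $$ (i, j) = krylov B (P * Z) p $$ (i, j)"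
    using i j P Z by (simp add: krylov_def)
qed (use P Z in \<open>auto simp: krylov_def\<close>)

lemma mat_diag_pow: "mat_diag n f ^\<^sub>m l = mat_diag n (\<lambda>i. f i ^ l)"
proof (induction l)
  case 0
  show ?case by (auto simp: mat_diag_def)
next
  case (Suc l)
  then show ?case by (simp add: power_commutes)
qed

lemma mat_diag_mult_left_index:
  assumes "M \<in> carrier_mat n c" "i < n" "j < c"
  shows "(mat_diag n f * M) $$ (i, j) = f i * M $$ (i, j)"
  by (subst mat_diag_mult_left[OF assms(1)]) (use assms in auto)

lemma mat_diag_mult_right_index:
  assumes "M \<in> carrier_mat r n" "i < r" "j < n"
  shows "(M * mat_diag n f) $$ (i, j) = M $$ (i, j) * f j"
  by (subst mat_diag_mult_right[OF assms(1)]) (use assms in auto)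

lemma krylov_mat_diag_index:
  assumes "Z \<in> carrier_mat n c" "i < n" "j < (p + 1) * c"
  shows "krylov (mat_diag n lam) Z p $$ (i, j) = lam i ^ (j div c) * Z $$ (i, j mod c)"
  using assms mod_less_of_less_mult[OF assms(3)]
  by (simp add: krylov_def mat_diag_pow mat_diag_mult_left_index)

text \<open>Quotient and remainder by \<open>b\<close> turn the sum into a double sum, which
  factors.\<close>

lemma sum_div_mod:
  fixes f g :: "nat \<Rightarrow> 'a :: semiring_0"
  shows "(\<Sum>j<a * b. f (j div b) * g (j mod b)) = (\<Sum>l<a. f l) * (\<Sum>j<b. g j)"
proof (induction a)
  case (Suc a)
  \<comment> \<open>On the last block the quotient is constantly \<open>a\<close> and the remainder
    runs through all values below \<open>b\<close>.\<close>
  have "(\<Sum>j\<in>{a * b..<a * b + b}. f (j div b) * g (j mod b)) = f a * (\<Sum>j<b. g j)"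
    using sum.shift_bounds_nat_ivl[of "\<lambda>j. f (j div b) * g (j mod b)" 0 "a * b" b]
    by (simp add: lessThan_atLeast0 add.commute sum_distrib_left)
  moreover have "{..<Suc a * b} = {..<a * b} \<union> {a * b..<a * b + b}" by auto
  ultimately show ?case
    using Suc by (simp add: sum.union_disjoint ivl_disj_int distrib_right)
qed simp

text \<open>Row \<open>i\<close> of the block matrix is the Kronecker product of row \<open>i\<close> of the Vandermonde matrix
  with row \<open>i\<close> of \<open>Z\<close>.\<close>

lemma vnorm_row_krylov_mat_diag:
  assumes Z: "Z \<in> carrier_mat n c" and i: "i < n"
  shows "vnorm (row (krylov (mat_diag n lam) Z p) i) = vnorm (row Z i) * vnorm (row (vander n lam p) i)"
proof -
  let ?K = "krylov (mat_diag n lam) Z p"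
  have K: "?K \<in> carrier_mat n ((p + 1) * c)" using Z by (auto simp: krylov_def)
  have "row ?K i \<bullet> row ?K i = (\<Sum>j<(p + 1) * c. (lam i ^ (j div c))\<^sup>2 * (Z $$ (i, j mod c))\<^sup>2)"
    using K i unfolding scalar_prod_def
    by (intro sum.cong) (auto simp: krylov_mat_diag_index[OF Z i, of _ p, simplified] power2_eq_square mult_ac)
  also have "\<dots> = (\<Sum>l<p + 1. (lam i ^ l)\<^sup>2) * (\<Sum>j<c. (Z $$ (i, j))\<^sup>2)"
    by (rule sum_div_mod)
  also have "(\<Sum>l<p + 1. (lam i ^ l)\<^sup>2) = row (vander n lam p) i \<bullet> row (vander n lam p) i"
    using i unfolding scalar_prod_def
    by (intro sum.cong) (auto simp: vander_def power2_eq_square)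
  also have "(\<Sum>j<c. (Z $$ (i, j))\<^sup>2) = row Z i \<bullet> row Z i"
    using i Z unfolding scalar_prod_def by (intro sum.cong) (auto simp: power2_eq_square)
  finally show ?thesis unfolding vnorm_def by (simp add: real_sqrt_mult)
qed

lemma vnorm_row_vander_pos:
  assumes "i < n"
  shows "vnorm (row (vander n lam p) i) > 0"
proof -
  have V: "row (vander n lam p) i \<in> carrier_vec (p + 1)"
    using row_carrier[of "vander n lam p" i] by (simp add: vander_def)
  \<comment> \<open>Column 0 holds \<open>lam i ^ 0\<close>, which is 1 even when
    \<open>lam i = 0\<close>.\<close>
  have "row (vander n lam p) i $ 0 = 1" using assms by (simp add: vander_def)
  then have "row (vander n lam p) i \<noteq> 0\<^sub>v (p + 1)" by auto
  then have "vnorm (row (vander n lam p) i) \<noteq> 0" using vnorm_eq_0_iff[OF V] by simp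
  then show ?thesis using vnorm_nonneg[of "row (vander n lam p) i"] by linarith
qed

section \<open>Selecting rows and columns, and inverting diagonal matrices\<close>

lemma qnorm_eq_vnorm_row:
  assumes "Q \<in> carrier_mat n n" "Z \<in> carrier_mat n c" "i < n"
  shows "qnorm Q Z i = vnorm (row (transpose_mat Q * Z) i)"
proof -
  have "transpose_mat Z *\<^sub>v col Q i = row (transpose_mat Q * Z) i"
    using assms by (intro eq_vecI) (auto intro: comm_scalar_prod[of _ n])
  then show ?thesis by (simp add: qnorm_def)
qed

lemma first_rows_mult:
  assumes "M \<in> carrier_mat r c" "N \<in> carrier_mat c s" "m \<le> r"
  shows "first_rows m M * N = first_rows m (M * N)"
proof (rule eq_matI)
  fix i j assume "i < dim_row (first_rows m (M * N))" "j < dim_col (first_rows m (M * N))"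
  then have i: "i < m" and j: "j < s" using assms by (auto simp: first_rows_def)
  have "row (first_rows m M) i = row M i"
    using assms i by (intro eq_vecI) (auto simp: first_rows_def)
  then show "(first_rows m M * N) $$ (i, j) = first_rows m (M * N) $$ (i, j)"
    using assms i j by (simp add: first_rows_def)
qed (use assms in \<open>auto simp: first_rows_def\<close>)

lemma col_first_cols:
  assumes "M \<in> carrier_mat r c" "j < k" "k \<le> c"
  shows "col (first_cols k M) j = col M j"
  using assms by (intro eq_vecI) (auto simp: first_cols_def)

lemma mult_first_cols_one:
  assumes N: "N \<in> carrier_mat c m" and k: "k \<le> m"
  shows "N * first_cols k (1\<^sub>m m) = first_cols k N"
proof (rule eq_matI)
  fix i j assume "i < dim_row (first_cols k N)" "j < dim_col (first_cols k N)"
  then have i: "i < c" and j: "j < k" using N by (auto simp: first_cols_def)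
  have "col (first_cols k (1\<^sub>m m)) j = unit_vec m j"
    using col_first_cols[OF one_carrier_mat j k] j k by simp
  then show "(N * first_cols k (1\<^sub>m m)) $$ (i, j) = first_cols k N $$ (i, j)"
    using N i j k by (simp add: first_cols_def)
qed (use N in \<open>auto simp: first_cols_def\<close>)

text \<open>The left inverse \<open>?E\<close> forces a trivial kernel, so
  \<open>mat_inverse\<close> yields some \<open>B\<close>, and then B = E D B = E.\<close>

lemma mat_inverse_mat_diag:
  fixes d :: "nat \<Rightarrow> 'a :: field"
  assumes d: "\<And>i. i < m \<Longrightarrow> d i \<noteq> 0"
  shows "the (mat_inverse (mat_diag m d)) = mat_diag m (\<lambda>i. 1 / d i)"
proof -
  let ?D = "mat_diag m d" and ?E = "mat_diag m (\<lambda>i. 1 / d i)"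
  have ED: "?E * ?D = 1\<^sub>m m"
    unfolding mat_diag_diag using d by (intro eq_matI) (auto simp: mat_diag_def)
  have "x = 0\<^sub>v m" if x: "x \<in> carrier_vec m" and 0: "?D *\<^sub>v x = 0\<^sub>v m" for x
  proof -
    have "x = ?E *\<^sub>v (?D *\<^sub>v x)" using assoc_mult_mat_vec[of ?E m m ?D m x] x ED by simp
    also have "\<dots> = 0\<^sub>v m" unfolding 0 by (auto simp: mat_diag_def)
    finally show ?thesis .
  qed
  then obtain B where B: "mat_inverse ?D = Some B" "B \<in> carrier_mat m m" "?D * B = 1\<^sub>m m"
    using ex_inverse_mat[of ?D m] by (metis mat_diag_dim)
  have "B = ?E * ?D * B" using B ED by simp
  also have "\<dots> = ?E" using assoc_mult_mat[of ?E m m ?D m B m] B right_mult_one_mat[of ?E m m]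
    by (simp del: mat_diag_diag)
  finally show ?thesis using B by simp
qed

section \<open>From row norms to quotients of maxima and minima\<close>

text \<open>Here \<open>w\<close>, \<open>a\<close> and \<open>b\<close> stand for the row norms of
  Q^T Y, of Q^T X and of the Vandermonde matrix. Hypothesis \<open>w\<close> allows any positive
  lower bound \<open>c\<close> of the products \<open>a j * b j\<close>; choosing the product of the
  two minima separates the two quotients.\<close>

lemma delta_quotient_bound:
  fixes a b w :: "nat \<Rightarrow> real"
  assumes k: "0 < k" "k \<le> m" "m < n"
    and a: "\<And>i. i < n \<Longrightarrow> 0 \<le> a i" "\<And>i. i < k \<Longrightarrow> 0 < a i"
    and b: "\<And>i. i < n \<Longrightarrow> 0 < b i"
    and s: "0 \<le> s"
    and w1: "\<And>i. i < k \<Longrightarrow> w i = 1"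
    and w0: "\<And>i. k \<le> i \<Longrightarrow> i < m \<Longrightarrow> w i = 0"
    and w: "\<And>i c. m \<le> i \<Longrightarrow> i < n \<Longrightarrow> 0 < c \<Longrightarrow> (\<And>j. j < k \<Longrightarrow> c \<le> a j * b j) \<Longrightarrow> w i \<le> a i * b i / c * s"
  shows "(MAX i\<in>{k..<n}. w i) / (MIN i\<in>{..<k}. w i)
      \<le> (MAX i\<in>{m..<n}. a i) / (MIN i\<in>{..<k}. a i) * ((MAX i\<in>{m..<n}. b i) / (MIN i\<in>{..<k}. b i)) * s"
    (is "_ \<le> ?Ma / ?ma * (?Mb / ?mb) * s")
proof -
  have mw: "(MIN i\<in>{..<k}. w i) = 1"
  proof -
    have "w ` {..<k} = {1}" using w1 k by force
    then show ?thesis by simp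
  qed
  have ma: "0 < ?ma" using k a by (subst Min_gr_iff) auto
  have mb: "0 < ?mb" using k b by (subst Min_gr_iff) auto
  have c: "?ma * ?mb \<le> a j * b j" if "j < k" for j
  proof (rule mult_mono)
    show "?ma \<le> a j" "?mb \<le> b j" using that by auto
    show "0 \<le> a j" using a(2)[OF that] by simp
  qed (use mb in simp)
  have Ma: "a i \<le> ?Ma" and Mb: "b i \<le> ?Mb" if "m \<le> i" "i < n" for i
    using that by auto
  have Ma0: "0 \<le> ?Ma" using Ma[of m] a(1)[of m] k by linarith
  have Mb0: "0 \<le> ?Mb" using Mb[of m] b[of m] k by linarith
  \<comment> \<open>The maximum of \<open>w\<close> starts at \<open>k\<close>, those of
    \<open>a\<close> and \<open>b\<close> only at \<open>m\<close>; the indices in between are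
    covered by \<open>w0\<close>.\<close>
  have "w i \<le> ?Ma * ?Mb / (?ma * ?mb) * s" if i: "k \<le> i" "i < n" for i
  proof (cases "i < m")
    case True
    then show ?thesis using w0[OF i(1)] Ma0 Mb0 ma mb s by simp
  next
    case False
    then have "w i \<le> a i * b i / (?ma * ?mb) * s"
      using w[of i "?ma * ?mb"] i c ma mb by simp
    also have "\<dots> \<le> ?Ma * ?Mb / (?ma * ?mb) * s"
    proof (intro mult_right_mono divide_right_mono mult_mono)
      show "a i \<le> ?Ma" "b i \<le> ?Mb" using False i Ma Mb by auto
      show "0 \<le> b i" using b[OF i(2)] by simp
    qed (use ma mb s Ma0 in auto)
    finally show ?thesis .
  qed
  then have "(MAX i\<in>{k..<n}. w i) \<le> ?Ma * ?Mb / (?ma * ?mb) * s"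
    using k by (subst Max_le_iff) auto
  then show ?thesis using mw by simp
qed

section \<open>The rows of Q^T Y and the bounds on \<open>delta\<close>\<close>

theorem theorem4p3:
  fixes A Q X :: "real mat" and lam :: "nat \<Rightarrow> real" and n k p m :: nat
  assumes A: "A \<in> carrier_mat n n" "transpose_mat A = A"
    and Q: "Q \<in> carrier_mat n n" "transpose_mat Q * Q = 1\<^sub>m n" "Q * transpose_mat Q = 1\<^sub>m n"
    and eig: "A = Q * mat_diag n lam * transpose_mat Q"
    and ordered: "\<And>i j. i \<le> j \<Longrightarrow> j < n \<Longrightarrow> lam j \<le> lam i"
    and k: "k > 0" and pk: "(p + 1) * k < n"
    and m: "k \<le> m" "m \<le> k + p * k"
    and X: "X \<in> carrier_mat n k"
    and G1: "rows_lin_indpt (G1mat lam Q X p m)"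
  shows "delta Q k (Ymat A lam Q X p m)
           \<le> Gamma k m (transpose_mat Q * X) * Gamma k m (vander n lam p)
              * spectral_norm (pinv (G1mat lam Q X p m) * first_cols k (1\<^sub>m m))
       \<and> ((MAX j\<in>{k..<n}. qnorm Q X j) \<noteq> 0 \<longrightarrow>
          delta Q k (Ymat A lam Q X p m) / delta Q k X
           \<le> (MAX j\<in>{m..<n}. qnorm Q X j) / (MAX j\<in>{k..<n}. qnorm Q X j)
              * Gamma k m (vander n lam p)
              * spectral_norm (pinv (G1mat lam Q X p m) * first_cols k (1\<^sub>m m)))"
proof -
  define T where "T = transpose_mat Q"
  define d where "d i = vnorm (row (Ghat lam Q X p) i)" for i
  define c where "c = (p + 1) * k"
  let ?H = "Ghat lam Q X p" and ?G = "Gmat lam Q X p" and ?G1 = "G1mat lam Q X p m"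
  let ?Y = "Ymat A lam Q X p m"
  define B where "B = pinv ?G1"
  define N where "N = B * first_cols k (1\<^sub>m m)"
  have mn: "m < n" using m pk by (simp add: algebra_simps)
  have T: "T \<in> carrier_mat n n" and TX: "T * X \<in> carrier_mat n k" using Q X by (auto simp: T_def)
  have Hdef: "?H = krylov (mat_diag n lam) (T * X) p" using X by (simp add: Ghat_def T_def)
  have H: "?H \<in> carrier_mat n c" unfolding Hdef c_def by (rule krylov_carrier[OF TX])
  have D: "Dmat lam Q X p = mat_diag n d" using X by (simp add: Dmat_def d_def[abs_def])
  have d_eq: "d i = vnorm (row (T * X) i) * vnorm (row (vander n lam p) i)" if "i < n" for i
    unfolding d_def Hdef by (rule vnorm_row_krylov_mat_diag[OF TX that])
  have Gdef: "?G = mat_diag n (\<lambda>i. if d i \<noteq> 0 then 1 / d i else 0) * ?H"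
    unfolding Gmat_def D diag_pinv_def
    by (rule arg_cong[of _ _ "\<lambda>M. M * ?H"]) (auto simp: mat_diag_def)
  have G: "?G \<in> carrier_mat n c" unfolding Gdef by (rule mult_carrier_mat[OF mat_diag_dim H])
  have G_index: "?G $$ (i, j) = (if d i \<noteq> 0 then 1 / d i else 0) * ?H $$ (i, j)" if "i < n" "j < c" for i j
    unfolding Gdef by (rule mat_diag_mult_left_index[OF H that])
  have dims: "dim_row ?G = n" "dim_col ?G = c" "dim_row ?H = n" "dim_col ?H = c"
    using G H by (simp_all only: carrier_matD)
  have G_row: "row ?G i = (if d i \<noteq> 0 then 1 / d i else 0) \<cdot>\<^sub>v row ?H i" if "i < n" for i
    by (rule eq_vecI) (simp_all add: dims that G_index)
  \<comment> \<open>The norm is 1 if \<open>d i\<close> is nonzero; otherwise the default 0 in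
    \<open>diag_pinv\<close> makes the row vanish.\<close>
  have G_row_norm: "vnorm (row ?G i) \<le> 1" if "i < n" for i
    using G_row[OF that] by (auto simp: vnorm_smult d_def[symmetric])
  \<comment> \<open>Although \<open>D\<close> may be singular, nothing is lost: where
    \<open>d i\<close> is 0, row \<open>i\<close> of \<open>?H\<close> has norm 0 and is itself
    zero.\<close>
  have DG: "mat_diag n d * ?G = ?H"
  proof (rule eq_matI)
    fix i j assume "i < dim_row ?H" "j < dim_col ?H"
    then have i: "i < n" and j: "j < c" using H by auto
    have 0: "?H $$ (i, j) = 0" if "d i = 0"
    proof -
      have "row ?H i = 0\<^sub>v c"
        using that vnorm_eq_0_iff[of "row ?H i" c] H i by (auto simp: d_def)
      then have "row ?H i $ j = 0\<^sub>v c $ j" by simp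
      then show ?thesis using H i j by simp
    qed
    show "(mat_diag n d * ?G) $$ (i, j) = ?H $$ (i, j)"
      using 0 mat_diag_mult_left_index[OF G i j, of d] G_index[OF i j] by auto
  qed (simp_all add: dims mat_diag_def)
  have G1c: "?G1 \<in> carrier_mat m c" using G by (intro carrier_matI) (simp_all add: G1mat_def first_rows_def)
  have Bc: "B \<in> carrier_mat c m" and G1B: "?G1 * B = 1\<^sub>m m"
    unfolding B_def by (rule full_row_rank_pinv[OF G1c G1])+
  have GB: "(?G * B) $$ (i, j) = (if i = j then 1 else 0)" if "i < m" "j < m" for i j
  proof -
    have "first_rows m (?G * B) = 1\<^sub>m m"
      using first_rows_mult[OF G Bc, of m] mn G1B by (simp add: G1mat_def)
    then have "first_rows m (?G * B) $$ (i, j) = 1\<^sub>m m $$ (i, j)" by simp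
    then show ?thesis using that G Bc by (simp add: first_rows_def)
  qed
  \<comment> \<open>If \<open>d i\<close> were 0, row \<open>i\<close> of \<open>?G\<close> would
    vanish, contradicting the diagonal entry 1 of \<open>?G * B\<close>. Thus the independence
    assumption makes \<open>D1mat\<close> invertible.\<close>
  have d0: "d i \<noteq> 0" if i: "i < m" for i
  proof
    assume "d i = 0"
    then have "row ?G i = 0 \<cdot>\<^sub>v row ?H i" using G_row i mn by simp
    also have "\<dots> = 0\<^sub>v c" using H i mn by (intro eq_vecI) auto
    finally have "(?G * B) $$ (i, i) = 0" using i mn G Bc by simp
    then show False using GB[OF i i] by simp
  qed
  have D1: "D1mat lam Q X p m = mat_diag m d"
    unfolding D1mat_def D first_cols_def first_rows_def using mn
    by (intro eq_matI) (auto simp: mat_diag_def)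
  let ?E = "mat_diag m (\<lambda>i. 1 / d i)"
  have K: "krylov A X p \<in> carrier_mat n c" unfolding c_def by (rule krylov_carrier[OF X])
  have KB: "krylov A X p * B \<in> carrier_mat n m" using K Bc by auto
  have Ydef: "?Y = first_cols k (krylov A X p * B * ?E)"
    unfolding Ymat_def Yp_def D1 B_def[symmetric] using X d0 by (simp add: mat_inverse_mat_diag)
  have Y: "?Y \<in> carrier_mat n k" using K KB by (intro carrier_matI) (simp_all add: Ydef first_cols_def)
  have TK: "T * krylov A X p = ?H"
  proof -
    have "T * A = mat_diag n lam * T"
    proof -
      let ?L = "mat_diag n lam"
      have L: "?L \<in> carrier_mat n n" by simp
      have LT: "?L * T \<in> carrier_mat n n" by (rule mult_carrier_mat[OF L T])
      have "A = Q * (?L * T)" using eig assoc_mult_mat[OF Q(1) L T] by (simp add: T_def)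
      then have "T * A = T * Q * (?L * T)" using assoc_mult_mat[OF T Q(1) LT] by simp
      then show ?thesis using Q(2) left_mult_one_mat[OF LT] by (simp add: T_def)
    qed
    then show ?thesis unfolding Hdef by (intro mult_krylov[OF A(1) _ T _ X]) auto
  qed
  \<comment> \<open>Entrywise form of Q^T Y = D G B E, restricted to the first \<open>k\<close>
    columns, with \<open>?E\<close> the inverse of \<open>D1mat\<close>.\<close>
  have TY: "(T * ?Y) $$ (i, j) = d i * (?G * B) $$ (i, j) / d j" if i: "i < n" and j: "j < k" for i j
  proof -
    have GBc: "?G * B \<in> carrier_mat n m" using G Bc by auto
    have jm: "j < m" using j m by simp
    have KBE: "krylov A X p * B * ?E \<in> carrier_mat n m"
      by (rule mult_carrier_mat[OF KB mat_diag_dim])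
    have "col ?Y j = col (krylov A X p * B * ?E) j"
      unfolding Ydef by (rule col_first_cols[OF KBE j m(1)])
    then have "(T * ?Y) $$ (i, j) = (T * (krylov A X p * B * ?E)) $$ (i, j)"
      using i j jm carrier_matD[OF T] carrier_matD[OF Y] carrier_matD[OF KBE] by simp
    also have "T * (krylov A X p * B * ?E) = mat_diag n d * (?G * B) * ?E"
    proof -
      have "T * (krylov A X p * B * ?E) = T * (krylov A X p * B) * ?E"
        using assoc_mult_mat[OF T KB, of ?E m] by simp
      also have "T * (krylov A X p * B) = ?H * B"
        using assoc_mult_mat[OF T K Bc] TK by simp
      also have "\<dots> = mat_diag n d * (?G * B)"
        using assoc_mult_mat[OF _ G Bc, of "mat_diag n d" n] DG by simp
      finally show ?thesis .
    qed
    also have "\<dots> $$ (i, j) = d i * (?G * B) $$ (i, j) / d j"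
      using mat_diag_mult_right_index[OF mult_carrier_mat[OF mat_diag_dim GBc] i jm]
        mat_diag_mult_left_index[OF GBc i jm] by simp
    finally show ?thesis .
  qed
  have TYc: "T * ?Y \<in> carrier_mat n k" using T Y by auto
  have TY_row: "row (T * ?Y) i $ j = d i * (?G * B) $$ (i, j) / d j" if i: "i < n" and j: "j < k" for i j
    using index_row(1)[of i "T * ?Y" j] carrier_matD[OF TYc] TY[OF i j] i j by metis
  let ?w = "\<lambda>i. vnorm (row (T * ?Y) i)"
  have w1: "?w i = 1" if i: "i < k" for i
  proof -
    \<comment> \<open>The two scalings \<open>d i\<close> and \<open>1 / d j\<close> cancel on the
      diagonal, the only place where \<open>?G * B\<close> is nonzero in these rows.\<close>
    have "row (T * ?Y) i = unit_vec k i"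
    proof (rule eq_vecI)
      fix j assume "j < dim_vec (unit_vec k i :: real vec)"
      then have j: "j < k" by simp
      then have "row (T * ?Y) i $ j = d i * (if i = j then 1 else 0) / d j"
        using TY_row[of i j] GB[of i j] i m mn by (simp del: index_mult_mat index_row)
      then show "row (T * ?Y) i $ j = unit_vec k i $ j" using d0 i j m by (simp add: unit_vec_def)
    qed (use TYc in auto)
    then show ?thesis using i by (simp add: vnorm_unit_vec)
  qed
  have w0: "?w i = 0" if i: "k \<le> i" "i < m" for i
  proof -
    have "row (T * ?Y) i = 0\<^sub>v k"
    proof (rule eq_vecI)
      fix j assume "j < dim_vec (0\<^sub>v k :: real vec)"
      then have j: "j < k" by simp
      then show "row (T * ?Y) i $ j = 0\<^sub>v k $ j"
        using TY_row[of i j] GB[of i j] i m mn by (simp del: index_mult_mat index_row)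
    qed (use TYc in auto)
    then show ?thesis by simp
  qed
  have N_eq: "N = first_cols k B" unfolding N_def by (rule mult_first_cols_one[OF Bc m(1)])
  have Nc: "N \<in> carrier_mat c k" using Bc by (intro carrier_matI) (simp_all add: N_eq first_cols_def)
  have w: "?w i \<le> d i / e * spectral_norm N"
    if i: "m \<le> i" "i < n" and e: "0 < e" "\<And>j. j < k \<Longrightarrow> e \<le> d j" for i e
  proof -
    let ?v = "transpose_mat N *\<^sub>v row ?G i"
    have di: "0 \<le> d i" by (simp add: d_def)
    \<comment> \<open>Entry \<open>j\<close> carries its own factor \<open>1 / d j\<close>;
      replacing each by the common bound \<open>1 / e\<close> leaves a multiple of row
      \<open>i\<close> of \<open>?G\<close> times \<open>N\<close>, written as a column.\<close>
    have "?w i \<le> vnorm ((d i / e) \<cdot>\<^sub>v ?v)"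
    proof (rule vnorm_mono)
      show "dim_vec (row (T * ?Y) i) = dim_vec ((d i / e) \<cdot>\<^sub>v ?v)" using Y Nc by simp
      fix j assume "j < dim_vec ((d i / e) \<cdot>\<^sub>v ?v)"
      then have j: "j < k" using Nc by simp
      have "col N j = col B j" unfolding N_eq by (rule col_first_cols[OF Bc j m(1)])
      then have "?v $ j = (?G * B) $$ (i, j)"
        using Nc Bc G i j m comm_scalar_prod[of "col B j" c "row ?G i"] by auto
      then have "row (T * ?Y) i $ j = d i * ?v $ j / d j"
        using TY_row[of i j] i j by (simp del: index_mult_mat index_row)
      then have "\<bar>row (T * ?Y) i $ j\<bar> = d i * \<bar>?v $ j\<bar> / d j"
        using di e j by (simp add: abs_mult d_def)
      also have "\<dots> \<le> d i * \<bar>?v $ j\<bar> / e"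
        using di e(1) e(2)[OF j] by (intro divide_left_mono mult_nonneg_nonneg mult_pos_pos) auto
      also have "\<dots> = \<bar>((d i / e) \<cdot>\<^sub>v ?v) $ j\<bar>"
        using di e(1) Nc j by (simp add: abs_mult)
      finally show "\<bar>row (T * ?Y) i $ j\<bar> \<le> \<bar>((d i / e) \<cdot>\<^sub>v ?v) $ j\<bar>" .
    qed
    also have "\<dots> = d i / e * vnorm ?v" using di e(1) by (simp add: vnorm_smult)
    also have "\<dots> \<le> d i / e * spectral_norm N"
    proof (rule mult_left_mono)
      have "vnorm ?v \<le> spectral_norm N * vnorm (row ?G i)"
        using Nc G i by (intro vnorm_transpose_mult_vec_le) auto
      also have "\<dots> \<le> spectral_norm N"
        using G_row_norm[OF i(2)] spectral_norm_nonneg by (simp add: mult_left_le)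
      finally show "vnorm ?v \<le> spectral_norm N" .
    qed (use di e(1) in simp)
    finally show ?thesis .
  qed
  let ?a = "\<lambda>i. vnorm (row (T * X) i)" and ?b = "\<lambda>i. vnorm (row (vander n lam p) i)"
  \<comment> \<open>\<open>d i\<close> is nonzero and has \<open>?a i\<close> as a factor.\<close>
  have a_pos: "0 < ?a i" if "i < k" for i
    using d0[of i] d_eq[of i] that m mn vnorm_nonneg[of "row (T * X) i"] by (auto simp: less_le)
  have bound: "(MAX i\<in>{k..<n}. ?w i) / (MIN i\<in>{..<k}. ?w i)
      \<le> (MAX i\<in>{m..<n}. ?a i) / (MIN i\<in>{..<k}. ?a i) * ((MAX i\<in>{m..<n}. ?b i) / (MIN i\<in>{..<k}. ?b i))
        * spectral_norm N"
  \<comment> \<open>Through \<open>d_eq\<close>, the lower bounds on \<open>?a j * ?b j\<close> are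
    exactly the lower bounds on \<open>d j\<close> used in \<open>w\<close>.\<close>
  proof (rule delta_quotient_bound[OF k m(1) mn])
    show "?w i \<le> ?a i * ?b i / e * spectral_norm N"
      if "m \<le> i" "i < n" "0 < e" "\<And>j. j < k \<Longrightarrow> e \<le> ?a j * ?b j" for i e
      using w[OF that(1,2,3)] that(2,4) d_eq m mn by simp
  qed (use a_pos w1 w0 vnorm_row_vander_pos spectral_norm_nonneg in auto)
  have q_image: "qnorm Q Z ` S = (\<lambda>i. vnorm (row (T * Z) i)) ` S"
    if "Z \<in> carrier_mat n k" "S \<subseteq> {..<n}" for Z S
    unfolding T_def using qnorm_eq_vnorm_row[OF Q(1) that(1)] that(2) by (intro image_cong) auto
  have delta_eq: "delta Q k Z = (MAX i\<in>{k..<n}. vnorm (row (T * Z) i)) / (MIN i\<in>{..<k}. vnorm (row (T * Z) i))"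
    if Z: "Z \<in> carrier_mat n k" for Z
    unfolding delta_def carrier_matD(1)[OF Z]
    using q_image[OF Z, of "{k..<n}"] q_image[OF Z, of "{..<k}"] m mn by fastforce
  note deltaY = delta_eq[OF Y] and deltaX = delta_eq[OF X]
  have maxX: "(MAX j\<in>{l..<n}. qnorm Q X j) = (MAX i\<in>{l..<n}. ?a i)" for l
    using q_image[OF X, of "{l..<n}"] by fastforce
  have GX: "Gamma k m (transpose_mat Q * X) = (MAX i\<in>{m..<n}. ?a i) / (MIN i\<in>{..<k}. ?a i)"
    unfolding Gamma_def T_def using Q by simp
  have GV: "Gamma k m (vander n lam p) = (MAX i\<in>{m..<n}. ?b i) / (MIN i\<in>{..<k}. ?b i)"
    unfolding Gamma_def by (simp add: vander_def)
  have first: "delta Q k ?Y \<le> Gamma k m (transpose_mat Q * X) * Gamma k m (vander n lam p) * spectral_norm N"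
    unfolding deltaY GX GV by (rule bound)
  let ?ma = "MIN i\<in>{..<k}. ?a i" and ?Mk = "MAX i\<in>{k..<n}. ?a i" and ?Mm = "MAX i\<in>{m..<n}. ?a i"
  have ma: "0 < ?ma" using k a_pos by (subst Min_gr_iff) auto
  have "?a k \<le> ?Mk" using m mn by (intro Max_ge) auto
  then have Mk: "0 \<le> ?Mk" using vnorm_nonneg order.trans by blast
  \<comment> \<open>Dividing the first bound by \<open>delta Q k X\<close>, which is
    \<open>?Mk / ?ma\<close> and positive under the guard, cancels \<open>?ma\<close>.\<close>
  have second: "delta Q k ?Y / delta Q k X \<le> ?Mm / ?Mk * Gamma k m (vander n lam p) * spectral_norm N"
    if nz: "?Mk \<noteq> 0"
  proof -
    have Mk': "0 < ?Mk" using nz Mk by simp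
    have "delta Q k ?Y / delta Q k X
        \<le> ?Mm / ?ma * Gamma k m (vander n lam p) * spectral_norm N / (?Mk / ?ma)"
      using first ma Mk' unfolding GX deltaX by (intro divide_right_mono) auto
    also have "\<dots> = ?Mm / ?Mk * Gamma k m (vander n lam p) * spectral_norm N"
      using ma by simp
    finally show ?thesis .
  qed
  show ?thesis
    using first second unfolding maxX N_def B_def by blast
qed

end
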